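(* Let $(A,\mathrm{m},T)$ be a measure-preserving dynamical system, with $\mathrm{m}$ a recurrent $\sigma$-finite measure. Let $B\subset A$ be measurable with $0<\mathrm{m}(B)\le +\infty$. Let $p\in[1,\infty]$ and let $f,g\in \mathbb{L}^p(A,\mathrm{m})$ be such that $g\equiv 0$ on $B^c$ and $$(I-\mathcal{L})f=g .$$ Then $$(I-\mathcal{L}_B)f_{|B}=g_{|B}.$$
   Context: $A$ is a Polish space, $T:A\to A$ is measurable, and $\mathrm{m}$ is a $\sigma$-finite (possibly finite) $T$-invariant measure on $A$. The system (or the measure $\mathrm{m}$) is recurrent if for every measurable $E\subset A$ with $\mathrm{m}(E)>0$, for $\mathrm{m}$-almost every $x\in E$ there is $n\ge1$ with $T^n(x)\in E$. For measurable $B$ with $\mathrm{m}(B)>0$, the first hitting time is $\varphi_B(x):=\inf\{n\ge 1: T^n(x)\in B\}$ (for $x\in A$), which is finite almost everywhere on $B$ by recurrence, and the induced map is $T_B:B\to B$, $T_B(x):=T^{\varphi_B(x)}(x)$, defined $\mathrm{m}$-almost everywhere on $B$; it preserves $\mathrm{m}_{|B}$. With $1/p+1/q=1$, the transfer operators $\mathcal{L}$ on $\mathbb{L}^p(A,\mathrm{m})$ and $\mathcal{L}_B$ on $\mathbb{L}^p(B,\mathrm{m}_{|B})$ are defined by $$\int_A \mathcal{L}(f)\cdot h\,d\mathrm{m}=\int_A f\cdot h\circ T\,d\mathrm{m}\quad \forall f\in\mathbb{L}^p(A,\mathrm{m}),\ \forall h\in\mathbb{L}^q(A,\mathrm{m}),$$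 $$\int_B \mathcal{L}_B(f)\cdot h\,d\mathrm{m}=\int_B f\cdot h\circ T_B\,d\mathrm{m}\quad \forall f\in\mathbb{L}^p(B,\mathrm{m}),\ \forall h\in\mathbb{L}^q(B,\mathrm{m}).$$ Equalities between functions are in $\mathbb{L}^p$ (i.e. almost everywhere). *)

theory Defs
  imports "HOL-Analysis.Analysis"
begin

text \<open>
  Elements of \<open>L\<^sup>p\<close> are represented by functions; equality in \<open>L\<^sup>p\<close> is equality almost
  everywhere.  The sort of the scalars has, up to isomorphism, exactly the two instances
  \<^typ>\<open>real\<close> and \<^typ>\<open>complex\<close>, so both the real and the complex spaces are covered.
\<close>

definition Lp :: "'a measure \<Rightarrow> ennreal \<Rightarrow> ('a \<Rightarrow> 'k::{real_normed_field, euclidean_space}) set"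
  where
  "Lp M p = {f \<in> borel_measurable M.
     if p = \<infinity> then \<exists>C::real. AE x in M. norm (f x) \<le> C
     else integrable M (\<lambda>x. norm (f x) powr enn2real p)}"

definition measure_preserving_map :: "'a measure \<Rightarrow> ('a \<Rightarrow> 'a) \<Rightarrow> bool" where
  "measure_preserving_map M T \<longleftrightarrow> T \<in> measurable M M \<and> distr M M T = M"

definition recurrent :: "'a measure \<Rightarrow> ('a \<Rightarrow> 'a) \<Rightarrow> bool" where
  "recurrent M T \<longleftrightarrow>
     (\<forall>E\<in>sets M. emeasure M E > 0 \<longrightarrow> (AE x in M. x \<in> E \<longrightarrow> (\<exists>n\<ge>1. (T ^^ n) x \<in> E)))"

definition hitting_time :: "('a \<Rightarrow> 'a) \<Rightarrow> 'a set \<Rightarrow> 'a \<Rightarrow> enat" where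
  "hitting_time T B x = Inf {enat n | n. 1 \<le> n \<and> (T ^^ n) x \<in> B}"

text \<open>
  On the null set of points of \<open>B\<close> that never return to \<open>B\<close>, where the induced map is usually
  left undefined, we let it be the identity.  The induced map is then a measurable map from
  \<open>B\<close> to \<open>B\<close>; an unspecified value there could make \<open>h \<circ> T\<^sub>B\<close> non-measurable,
  because the measures are not assumed to be complete.
\<close>

definition induced_map :: "('a \<Rightarrow> 'a) \<Rightarrow> 'a set \<Rightarrow> 'a \<Rightarrow> 'a" where
  "induced_map T B x = (case hitting_time T B x of enat n \<Rightarrow> (T ^^ n) x | \<infinity> \<Rightarrow> x)"

text \<open>
  The duality relation determines the transfer operator only up to null sets;
  the definition selects one representative of \<open>\<L> f\<close>.  In \<^typ>\<open>ennreal\<close> we have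
  \<open>1 / \<infinity> = 0\<close>, so the equation relating \<open>p\<close> and \<open>q\<close> includes the two endpoint cases.
\<close>

definition transfer_operator ::
  "'a measure \<Rightarrow> ('a \<Rightarrow> 'a) \<Rightarrow> ennreal \<Rightarrow> ('a \<Rightarrow> 'k) \<Rightarrow> ('a \<Rightarrow> 'k::{real_normed_field, euclidean_space})"
  where
  "transfer_operator M T p f = (SOME u. u \<in> Lp M p \<and>
     (\<forall>q. 1 / p + 1 / q = 1 \<longrightarrow>
       (\<forall>h\<in>Lp M q. (\<integral>x. u x * h x \<partial>M) = (\<integral>x. f x * h (T x) \<partial>M))))"

end

theory Submission
  imports Defs
begin

text \<open>
  Write \<open>S\<close> for the induced map, \<open>\<phi>\<close> for the hitting time of \<open>B\<close> and \<open>u = \<L> f\<close>, so that \<open>f = u\<close>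
  almost everywhere off \<open>B\<close> and \<open>g = f - u\<close>.  It has to be shown that \<open>u\<close>, restricted to \<open>B\<close>, is
  \<open>\<L>\<^sub>B f\<close>, that is, that \<open>\<integral> u h = \<integral>\<^sub>B f (h \<circ> S)\<close> for every \<open>h \<in> L\<^sup>q\<close> vanishing off \<open>B\<close>.

  By duality \<open>\<integral> u h = \<integral> f (h \<circ> T)\<close>, an integral over \<open>{\<phi> = 1}\<close>.  On the part of this set inside \<open>B\<close>
  the integrand is \<open>f (h \<circ> S)\<close>; on the part outside \<open>B\<close> one may replace \<open>f\<close> by \<open>u\<close> and apply duality
  again, which yields an integral over \<open>{\<phi> = 2}\<close>.  Iterating this gives (\<open>first_return_duality\<close>)
  \<open>\<integral> u h = \<integral>\<^bsub>B \<inter> {\<phi> \<le> n}\<^esub> f (h \<circ> S) + \<integral>\<^bsub>{\<phi> = n+1}\<^esub> f (h \<circ> T\<^sup>n\<^sup>+\<^sup>1)\<close>.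
  The first term tends to \<open>\<integral>\<^sub>B f (h \<circ> S)\<close>, because \<open>\<phi>\<close> is finite almost everywhere on \<open>B\<close>.

  The remainder is handled for all exponents at once.  Young's inequality, or boundedness of one
  factor at the endpoints, gives \<open>|f x| |h y| \<le> F x + H y\<close> with \<open>F\<close> and \<open>H\<close> of finite integral
  (\<open>Lp_product_separation\<close>).  The integrals of \<open>F\<close> over the disjoint sets \<open>{\<phi> = n}\<close> tend to \<open>0\<close>.  For
  \<open>H\<close> the same first return decomposition, with invariance of the measure in place of duality, shows
  that \<open>\<integral>\<^bsub>{\<phi> = n+1}\<^esub> H \<circ> T\<^sup>n\<^sup>+\<^sup>1\<close> equals \<open>\<integral>\<^sub>B H - \<integral>\<^bsub>B \<inter> {\<phi> \<le> n}\<^esub> H \<circ> S\<close>; its limit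
  is \<open>\<integral>\<^sub>B H - \<integral>\<^sub>B H \<circ> S\<close>, which is \<open>0\<close> because \<open>S\<close> preserves the measure on \<open>B\<close>
  (\<open>induced_map_preserving\<close>).

  Since the transfer operator is a selected solution of the duality relation, one also needs that a
  solution exists for \<open>T\<close>; it is built from Radon-Nikodym densities (\<open>transfer_dual_exists\<close>).  For
  \<open>S\<close> the function \<open>u\<close> itself is a solution, and uniqueness (\<open>transfer_dual_unique\<close>) identifies it
  with the selected one.
\<close>

section \<open>Spaces of p-integrable functions\<close>

lemma Lp_measurable: "f \<in> Lp M p \<Longrightarrow> f \<in> borel_measurable M"
  by (simp add: Lp_def)

lemma Lp_dominated:
  assumes f: "f \<in> Lp M p" and g[measurable]: "g \<in> borel_measurable M"
    and le: "AE x in M. norm (g x) \<le> norm (f x)"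
  shows "g \<in> Lp M p"
proof (cases "p = \<infinity>")
  case True
  then obtain C :: real where "AE x in M. norm (f x) \<le> C"
    using f by (auto simp: Lp_def)
  with le have "AE x in M. norm (g x) \<le> C" by eventually_elim auto
  then show ?thesis using True by (auto simp: Lp_def)
next
  case False
  have int: "integrable M (\<lambda>x. norm (f x) powr enn2real p)" using f False by (simp add: Lp_def)
  have "integrable M (\<lambda>x. norm (g x) powr enn2real p)"
  proof (rule Bochner_Integration.integrable_bound[OF int])
    show "AE x in M. norm (norm (g x) powr enn2real p) \<le> norm (norm (f x) powr enn2real p)"
      using le by eventually_elim (auto intro: powr_mono2)
  qed measurable
  then show ?thesis using False by (simp add: Lp_def)
qed

lemma Lp_add:
  fixes f g :: "'a \<Rightarrow> 'k::{real_normed_field, euclidean_space}"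
  assumes f: "f \<in> Lp M p" and g: "g \<in> Lp M p"
  shows "(\<lambda>x. f x + g x) \<in> Lp M p"
proof -
  note [measurable] = Lp_measurable[OF f] Lp_measurable[OF g]
  show ?thesis
  proof (cases "p = \<infinity>")
    case True
    then obtain C D :: real where "AE x in M. norm (f x) \<le> C" "AE x in M. norm (g x) \<le> D"
      using f g by (auto simp: Lp_def)
    then have "AE x in M. norm (f x + g x) \<le> C + D"
      by eventually_elim (rule norm_triangle_mono)
    then show ?thesis using True by (auto simp: Lp_def)
  next
    case False
    define r where "r = enn2real p"
    have r: "r \<ge> 0" by (simp add: r_def)
    have int: "integrable M (\<lambda>x. 2 powr r * (norm (f x) powr r + norm (g x) powr r))"
      using f g False by (auto simp: Lp_def r_def)
    have "norm (f x + g x) powr r \<le> 2 powr r * (norm (f x) powr r + norm (g x) powr r)" for x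
    proof -
      have "norm (f x + g x) powr r \<le> (2 * max (norm (f x)) (norm (g x))) powr r"
        using r norm_triangle_ineq[of "f x" "g x"] by (intro powr_mono2) auto
      also have "\<dots> = 2 powr r * max (norm (f x)) (norm (g x)) powr r"
        by (simp add: powr_mult)
      also have "\<dots> \<le> 2 powr r * (norm (f x) powr r + norm (g x) powr r)"
        by (intro mult_left_mono) (auto simp: max_def)
      finally show ?thesis .
    qed
    then have "integrable M (\<lambda>x. norm (f x + g x) powr r)"
      by (intro Bochner_Integration.integrable_bound[OF int]) (auto intro: order_trans)
    then show ?thesis using False by (simp add: Lp_def r_def)
  qed
qed

lemma Lp_zero: "(\<lambda>x. 0) \<in> Lp M p"
  by (auto simp: Lp_def intro!: exI[of _ 0])

lemma Lp_sum:
  fixes f :: "'i \<Rightarrow> 'a \<Rightarrow> 'k::{real_normed_field, euclidean_space}"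
  assumes "\<And>i. i \<in> I \<Longrightarrow> f i \<in> Lp M p"
  shows "(\<lambda>x. \<Sum>i\<in>I. f i x) \<in> Lp M p"
  using assms by (induction I rule: infinite_finite_induct) (auto intro: Lp_add Lp_zero)

lemma Lp_indicator:
  assumes A: "A \<in> sets M" and fin: "emeasure M A < \<infinity>"
  shows "(indicator A :: 'a \<Rightarrow> 'k::{real_normed_field, euclidean_space}) \<in> Lp M p"
proof -
  have "norm (indicator A x :: 'k) powr enn2real p = indicator A x" for x
    by (auto simp: indicator_def)
  moreover have "AE x in M. norm (indicator A x :: 'k) \<le> 1"
    by (auto simp: indicator_def)
  ultimately show ?thesis
    using A fin by (auto simp: Lp_def integrable_indicator_iff)
qed

lemma Lp_compose:
  assumes T: "measure_preserving_map M T" and h: "h \<in> Lp M p"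
  shows "(\<lambda>x. h (T x)) \<in> Lp M p"
proof -
  have T_meas[measurable]: "T \<in> measurable M M" and distr: "distr M M T = M"
    using T by (auto simp: measure_preserving_map_def)
  note h_meas[measurable] = Lp_measurable[OF h]
  show ?thesis
  proof (cases "p = \<infinity>")
    case True
    then obtain C :: real where "AE x in M. norm (h x) \<le> C" using h by (auto simp: Lp_def)
    then have "AE x in distr M M T. norm (h x) \<le> C" by (subst distr)
    then have "AE x in M. norm (h (T x)) \<le> C"
      by (subst (asm) AE_distr_iff) auto
    then show ?thesis using True by (auto simp: Lp_def)
  next
    case False
    then have "integrable (distr M M T) (\<lambda>x. norm (h x) powr enn2real p)"
      using h by (simp add: Lp_def distr)
    then have "integrable M (\<lambda>x. norm (h (T x)) powr enn2real p)"
      by (subst (asm) integrable_distr_eq) auto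
    then show ?thesis using False by (simp add: Lp_def)
  qed
qed

lemma Lp_restrict_space:
  assumes B: "B \<in> sets M" and f: "f \<in> Lp M p"
  shows "f \<in> Lp (restrict_space M B) p"
proof -
  have [simp]: "B \<inter> space M \<in> sets M" using B by auto
  have "integrable (restrict_space M B) (\<lambda>x. norm (f x) powr enn2real p)" if "p \<noteq> \<infinity>"
    using f that B by (auto simp: Lp_def integrable_restrict_space
        intro!: integrable_mult_indicator simp flip: real_scaleR_def)
  then show ?thesis
    using f by (auto simp: Lp_def AE_restrict_space_iff intro: measurable_restrict_space1)
      (metis (mono_tags, lifting) eventually_mono)
qed

lemma Lp_extend_by_zero:
  fixes h :: "'a \<Rightarrow> 'k::{real_normed_field, euclidean_space}"
  assumes B: "B \<in> sets M" and h: "h \<in> Lp (restrict_space M B) p"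
  shows "(\<lambda>x. indicator B x *\<^sub>R h x) \<in> Lp M p"
proof -
  have [simp]: "B \<inter> space M \<in> sets M" using B by auto
  have meas: "(\<lambda>x. indicator B x *\<^sub>R h x) \<in> borel_measurable M"
    using h by (simp add: Lp_def borel_measurable_restrict_space_iff)
  show ?thesis
  proof (cases "p = \<infinity>")
    case True
    then obtain C :: real where "AE x in M. x \<in> B \<longrightarrow> norm (h x) \<le> C"
      using h by (auto simp: Lp_def AE_restrict_space_iff)
    then have "AE x in M. norm (indicator B x *\<^sub>R h x) \<le> max C 0"
      by eventually_elim (auto simp: indicator_def)
    then show ?thesis using True meas by (auto simp: Lp_def)
  next
    case False
    have "norm (indicator B x *\<^sub>R h x) powr enn2real p
        = indicator B x *\<^sub>R (norm (h x) powr enn2real p)" for x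
      by (auto simp: indicator_def)
    then show ?thesis using h False meas by (simp add: Lp_def integrable_restrict_space)
  qed
qed

section \<open>Conjugate exponents\<close>

lemma one_divide_ennreal_real:
  assumes "0 < r" shows "1 / ennreal r = ennreal (1 / r)"
  by (metis assms divide_ennreal ennreal_1 less_eq_real_def zero_le_one)

lemma one_divide_ennreal_eq_one:
  fixes q :: ennreal
  assumes "1 / q = 1" shows "q = 1"
proof (cases q)
  case (real r)
  then have "r > 0" using assms by (cases "r = 0") (auto simp: ennreal_divide_zero)
  then have "ennreal (1 / r) = ennreal 1" using real assms by (simp add: one_divide_ennreal_real)
  then show ?thesis using real \<open>r > 0\<close> by (subst (asm) ennreal_inj) auto
qed (use assms in auto)

lemma conjugate_exponent_cases:
  fixes p q :: ennreal
  assumes eq: "1 / p + 1 / q = 1"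
  obtains (one) "p = 1" "q = \<infinity>"
    | (infinity) "p = \<infinity>" "q = 1"
    | (finite) r s where "p = ennreal r" "q = ennreal s" "r > 1" "s > 1" "1 / r + 1 / s = 1"
proof -
  have p0: "p \<noteq> 0" and q0: "q \<noteq> 0" using eq by (auto simp: ennreal_divide_zero)
  consider "p = \<infinity>" | "q = \<infinity>" | "p \<noteq> \<infinity>" "q \<noteq> \<infinity>" by blast
  then show thesis
  proof cases
    case 1
    then have "1 / q = 1" using eq by simp
    with 1 show ?thesis by (intro infinity) (auto simp: one_divide_ennreal_eq_one)
  next
    case 2
    then have "1 / p = 1" using eq by simp
    with 2 show ?thesis by (intro one) (auto simp: one_divide_ennreal_eq_one)
  next
    case 3
    then obtain r s where rs: "p = ennreal r" "q = ennreal s" "r \<ge> 0" "s \<ge> 0"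
      by (metis ennreal_cases infinity_ennreal_def)
    then have "r > 0" "s > 0" using p0 q0 by (auto simp: less_le)
    then have "ennreal (1 / r + 1 / s) = ennreal 1"
      using eq rs by (simp add: one_divide_ennreal_real ennreal_plus[symmetric] del: ennreal_plus)
    then have sum: "1 / r + 1 / s = 1"
      using \<open>r > 0\<close> \<open>s > 0\<close> by (subst (asm) ennreal_inj) auto
    then have "1 / r < 1" "1 / s < 1" using \<open>r > 0\<close> \<open>s > 0\<close> by (smt (verit) divide_pos_pos)+
    then show ?thesis using \<open>r > 0\<close> \<open>s > 0\<close> rs sum by (intro finite) auto
  qed
qed

lemma conjugate_exponent_exists:
  fixes p :: ennreal
  assumes "1 \<le> p" obtains q where "1 / p + 1 / q = 1"
proof -
  consider "p = 1" | "p = \<infinity>" | "p \<noteq> 1" "p \<noteq> \<infinity>" by blast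
  then show thesis
  proof cases
    case 3
    then obtain r where r: "p = ennreal r" "r \<ge> 0" by (metis ennreal_cases infinity_ennreal_def)
    then have "r > 1" using assms 3
      by (metis ennreal_1 ennreal_le_iff less_eq_real_def)
    define s where "s = r / (r - 1)"
    have "s > 0" "1 / r + 1 / s = 1" using \<open>r > 1\<close> by (auto simp: s_def field_simps)
    then have "1 / p + 1 / ennreal s = 1"
      using \<open>r > 1\<close> r by (simp add: one_divide_ennreal_real ennreal_plus[symmetric] del: ennreal_plus)
    then show ?thesis by (rule that)
  qed (auto intro: that[of \<infinity>] that[of 1])
qed

text \<open>
  The points \<open>x\<close> and \<open>y\<close> are independent, so this bounds \<open>f (h \<circ> R)\<close> for every measure-preserving
  \<open>R\<close> by a sum of two functions that can be integrated separately.  Where an essential bound is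
  violated, \<open>F\<close> or \<open>H\<close> takes the value \<open>\<infinity>\<close>; hence the inequality holds without exceptional set, and
  no null set has to be transported when \<open>y = R x\<close> is substituted.
\<close>

lemma Lp_product_separation:
  assumes f: "f \<in> Lp M p" and h: "h \<in> Lp M q" and pq: "1 / p + 1 / q = 1"
  obtains F H :: "'a \<Rightarrow> ennreal"
  where "F \<in> borel_measurable M" "H \<in> borel_measurable M"
    and "(\<integral>\<^sup>+x. F x \<partial>M) < \<infinity>" "(\<integral>\<^sup>+x. H x \<partial>M) < \<infinity>"
    and "\<And>x y. ennreal (norm (f x) * norm (h y)) \<le> F x + H y"
proof -
  \<comment> \<open>This serves both \<open>p = 1\<close> and \<open>p = \<infinity>\<close>: one factor is integrable, the other one bounded.\<close>
  have endpoint: "\<exists>U V. U \<in> borel_measurable M \<and> V \<in> borel_measurable M \<and>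
      (\<integral>\<^sup>+x. U x \<partial>M) < \<infinity> \<and> (\<integral>\<^sup>+x. V x \<partial>M) < (\<infinity>::ennreal) \<and>
      (\<forall>x y. ennreal (u x * v y) \<le> U x + V y)"
    if int: "integrable M u" and [measurable]: "v \<in> borel_measurable M"
      and bdd: "\<exists>C::real. AE x in M. v x \<le> C" and nonneg: "\<And>x. 0 \<le> u x" "\<And>y. 0 \<le> v y"
    for u v :: "'a \<Rightarrow> real"
  proof -
    obtain C where C: "AE x in M. v x \<le> C" using bdd by blast
    define U where "U = (\<lambda>x. ennreal (\<bar>C\<bar> * u x))"
    define V where "V = (\<lambda>y. if v y \<le> C then 0 else \<infinity> :: ennreal)"
    have [measurable]: "u \<in> borel_measurable M" using int by auto
    have "(\<integral>\<^sup>+x. V x \<partial>M) = (\<integral>\<^sup>+x. 0 \<partial>M)"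
      using C by (intro nn_integral_cong_AE) (auto simp: V_def)
    moreover have "(\<integral>\<^sup>+x. U x \<partial>M) < \<infinity>"
      using int nonneg by (simp add: U_def nn_integral_eq_integral)
    moreover have "ennreal (u x * v y) \<le> U x + V y" for x y
    proof (cases "v y \<le> C")
      case True
      have "u x * v y \<le> u x * \<bar>C\<bar>" using True nonneg by (intro mult_left_mono) auto
      then show ?thesis using True by (simp add: U_def V_def mult.commute ennreal_leI)
    qed (auto simp: V_def)
    moreover have "U \<in> borel_measurable M" "V \<in> borel_measurable M"
      unfolding U_def V_def by measurable
    ultimately show ?thesis by (intro exI[of _ U] exI[of _ V]) simp
  qed
  note [measurable] = Lp_measurable[OF f] Lp_measurable[OF h]
  show thesis using pq
  proof (cases rule: conjugate_exponent_cases)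
    case one
    then have "integrable M (\<lambda>x. norm (f x))" "\<exists>C::real. AE x in M. norm (h x) \<le> C"
      using f h by (auto simp: Lp_def)
    from endpoint[OF this(1) _ this(2)] show ?thesis using that by auto
  next
    case infinity
    then have "integrable M (\<lambda>x. norm (h x))" "\<exists>C::real. AE x in M. norm (f x) \<le> C"
      using f h by (auto simp: Lp_def)
    from endpoint[OF this(1) _ this(2)] obtain U V where
      "U \<in> borel_measurable M" "V \<in> borel_measurable M"
      "(\<integral>\<^sup>+x. U x \<partial>M) < \<infinity>" "(\<integral>\<^sup>+x. V x \<partial>M) < (\<infinity>::ennreal)"
      "\<And>x y. ennreal (norm (h x) * norm (f y)) \<le> U x + V y"
      by auto
    then show ?thesis by (intro that[of V U]) (auto simp: mult.commute add.commute)
  next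
    case (finite r s)
    define F where "F = (\<lambda>x. ennreal (norm (f x) powr r))"
    define H where "H = (\<lambda>x. ennreal (norm (h x) powr s))"
    have "integrable M (\<lambda>x. norm (f x) powr r)" "integrable M (\<lambda>x. norm (h x) powr s)"
      using f h finite by (auto simp: Lp_def)
    then have "(\<integral>\<^sup>+x. F x \<partial>M) < \<infinity>" "(\<integral>\<^sup>+x. H x \<partial>M) < \<infinity>"
      by (auto simp: F_def H_def nn_integral_eq_integral)
    moreover have "ennreal (norm (f x) * norm (h y)) \<le> F x + H y" for x y
    proof -
      have div: "t / a \<le> t" if "t \<ge> 0" "a > 1" for t a :: real
        using that by (simp add: pos_divide_le_eq mult_ge1_I mult_le_cancel_left1)
      have "norm (f x) * norm (h y) \<le> norm (f x) powr r / r + norm (h y) powr s / s"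
        using finite by (intro Youngs_inequality) auto
      also have "\<dots> \<le> norm (f x) powr r + norm (h y) powr s"
        using finite by (intro add_mono div) auto
      finally show ?thesis
        by (simp add: F_def H_def ennreal_plus[symmetric] ennreal_leI del: ennreal_plus)
    qed
    moreover have "F \<in> borel_measurable M" "H \<in> borel_measurable M"
      unfolding F_def H_def by measurable
    ultimately show ?thesis by (intro that[of F H]) auto
  qed
qed

lemma Lp_product_integrable:
  assumes f: "f \<in> Lp M p" and h: "h \<in> Lp M q" and pq: "1 / p + 1 / q = 1"
  shows "integrable M (\<lambda>x. norm (f x) * norm (h x))"
proof -
  note [measurable] = Lp_measurable[OF f] Lp_measurable[OF h]
  obtain F H :: "'a \<Rightarrow> ennreal"
    where [measurable]: "F \<in> borel_measurable M" "H \<in> borel_measurable M"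
    and fin: "(\<integral>\<^sup>+x. F x \<partial>M) < \<infinity>" "(\<integral>\<^sup>+x. H x \<partial>M) < \<infinity>"
    and le: "\<And>x y. ennreal (norm (f x) * norm (h y)) \<le> F x + H y"
    using Lp_product_separation[OF assms] by blast
  have "(\<integral>\<^sup>+x. ennreal (norm (f x) * norm (h x)) \<partial>M) \<le> (\<integral>\<^sup>+x. F x + H x \<partial>M)"
    by (intro nn_integral_mono le)
  also have "\<dots> < \<infinity>" using fin by (simp add: nn_integral_add)
  finally show ?thesis by (intro integrableI_bounded) auto
qed

lemma Lp_times_integrable:
  fixes f h :: "'a \<Rightarrow> 'k::{real_normed_field, euclidean_space}"
  assumes f: "f \<in> Lp M p" and h: "h \<in> Lp M q" and pq: "1 / p + 1 / q = 1"
  shows "integrable M (\<lambda>x. f x * h x)"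
proof -
  note [measurable] = Lp_measurable[OF f] Lp_measurable[OF h]
  show ?thesis
    by (rule Bochner_Integration.integrable_bound[OF Lp_product_integrable[OF assms]])
      (auto simp: norm_mult)
qed

section \<open>Existence and uniqueness of the transfer operator\<close>

text \<open>
  The graph of \<open>t \<mapsto> t\<^sup>r\<close> lies above its tangent at \<open>y\<close>.  In contrast to Young's inequality this
  form includes \<open>r = 1\<close>, so that one argument bounds the transfer operator for all finite exponents.
\<close>

lemma power_tangent_inequality:
  fixes x y r :: real
  assumes "1 \<le> r" "0 \<le> x" "0 \<le> y"
  shows "r * (x * y powr (r - 1)) \<le> x powr r + (r - 1) * y powr r"
proof (cases "r = 1")
  case False
  then have "r > 1" using assms by simp
  define s where "s = r / (r - 1)"
  have s: "s > 1" "1 / r + 1 / s = 1" "(r - 1) * s = r" "r / s = r - 1"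
    using \<open>r > 1\<close> by (auto simp: s_def field_simps)
  have "x * y powr (r - 1) \<le> x powr r / r + (y powr (r - 1)) powr s / s"
    using s \<open>r > 1\<close> assms by (intro Youngs_inequality) auto
  also have "(y powr (r - 1)) powr s = y powr r" by (simp add: powr_powr s)
  finally have "r * (x * y powr (r - 1)) \<le> r * (x powr r / r + y powr r / s)"
    using \<open>r > 1\<close> by (intro mult_left_mono) auto
  also have "\<dots> = x powr r + (r / s) * y powr r" using \<open>r > 1\<close> by (simp add: field_simps)
  finally show ?thesis by (simp add: s)
qed (use assms in auto)

text \<open>
  The duality relation against nonnegative test functions says that \<open>v\<close> is the density of the
  image under \<open>T\<close> of the measure with density \<open>\<phi>\<close>.
\<close>

lemma nonneg_transfer_duality:
  fixes \<phi> v :: "'a \<Rightarrow> real"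
  assumes T: "measure_preserving_map M T" and [measurable]: "\<phi> \<in> borel_measurable M" "v \<in> borel_measurable M"
    and eq: "density M v = distr (density M \<phi>) M T" and [measurable]: "h \<in> borel_measurable M"
  shows "(\<integral>\<^sup>+x. ennreal (v x) * h x \<partial>M) = (\<integral>\<^sup>+x. ennreal (\<phi> x) * h (T x) \<partial>M)"
proof -
  have [measurable]: "T \<in> measurable M M" using T by (simp add: measure_preserving_map_def)
  have "(\<integral>\<^sup>+x. ennreal (v x) * h x \<partial>M) = (\<integral>\<^sup>+x. h x \<partial>density M v)"
    by (simp add: nn_integral_density)
  also have "\<dots> = (\<integral>\<^sup>+x. h (T x) \<partial>density M \<phi>)"
    unfolding eq by (subst nn_integral_distr) auto
  finally show ?thesis by (simp add: nn_integral_density)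
qed

lemma nn_integral_measure_preserving:
  assumes T: "measure_preserving_map M T" and h: "h \<in> borel_measurable M"
  shows "(\<integral>\<^sup>+x. h (T x) \<partial>M) = (\<integral>\<^sup>+x. h x \<partial>M)"
  using assms nn_integral_distr[of T M M h] by (simp add: measure_preserving_map_def)

text \<open>
  Invariance makes the image measure absolutely continuous, but it could a priori fail
  to be \<open>\<sigma>\<close>-finite, and its density could be infinite.  It is finite almost everywhere because
  its integral over a set \<open>A\<close> of finite measure is that of \<open>\<phi>\<close> times the indicator of \<open>A\<close> composed
  with \<open>T\<close>, a product of functions with conjugate exponents.
\<close>

lemma (in sigma_finite_measure) nonneg_transfer_density_exists:
  fixes \<phi> :: "'a \<Rightarrow> real"
  assumes T: "measure_preserving_map M T" and p: "1 \<le> p"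
    and \<phi>: "\<phi> \<in> Lp M p" and nonneg: "\<And>x. 0 \<le> \<phi> x"
  obtains v :: "'a \<Rightarrow> real"
  where "v \<in> borel_measurable M" "\<And>x. 0 \<le> v x" "density M v = distr (density M \<phi>) M T"
proof -
  have T_meas[measurable]: "T \<in> measurable M M" and distr: "distr M M T = M"
    using T by (auto simp: measure_preserving_map_def)
  note [measurable] = Lp_measurable[OF \<phi>]
  let ?N = "distr (density M \<phi>) M T"
  have "absolutely_continuous M ?N"
  proof -
    have "AE x in ?N. x \<notin> A" if A: "A \<in> null_sets M" for A
    proof -
      have [measurable]: "A \<in> sets M" using A by auto
      have "AE x in distr M M T. x \<notin> A" unfolding distr using A by (rule AE_not_in)
      then have "AE x in M. T x \<notin> A" by (subst (asm) AE_distr_iff) auto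
      then show ?thesis by (subst AE_distr_iff) (auto simp: AE_density)
    qed
    then show ?thesis
      unfolding absolutely_continuous_def
      by (intro subsetI) (subst AE_iff_null_sets, auto)
  qed
  then obtain u where u[measurable]: "u \<in> borel_measurable M" and dens: "density M u = ?N"
    using Radon_Nikodym by force
  have dual: "(\<integral>\<^sup>+x. u x * h x \<partial>M) = (\<integral>\<^sup>+x. ennreal (\<phi> x) * h (T x) \<partial>M)"
    if [measurable]: "h \<in> borel_measurable M" for h
  proof -
    have "(\<integral>\<^sup>+x. u x * h x \<partial>M) = (\<integral>\<^sup>+x. h x \<partial>?N)" by (simp add: nn_integral_density flip: dens)
    also have "\<dots> = (\<integral>\<^sup>+x. ennreal (\<phi> x) * h (T x) \<partial>M)"
      by (simp add: nn_integral_distr nn_integral_density)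
    finally show ?thesis .
  qed
  obtain q where pq: "1 / p + 1 / q = 1" using conjugate_exponent_exists[OF p] .
  obtain A :: "nat \<Rightarrow> 'a set" where A: "range A \<subseteq> sets M" "(\<Union>i. A i) = space M"
    "\<And>i. emeasure M (A i) \<noteq> \<infinity>"
    using sigma_finite by blast
  have "AE x in M. u x * indicator (A i) x \<noteq> \<infinity>" for i
  proof (rule nn_integral_noteq_infinite)
    have [measurable]: "A i \<in> sets M" using A by auto
    then show "(\<lambda>x. u x * indicator (A i) x) \<in> borel_measurable M" by measurable
    have "(indicator (A i) :: 'a \<Rightarrow> real) \<in> Lp M q"
      using A(3)[of i] by (intro Lp_indicator) (auto simp: less_top)
    then have "integrable M (\<lambda>x. norm (\<phi> x) * norm (indicator (A i) (T x) :: real))"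
      using Lp_compose[OF T] Lp_product_integrable[OF \<phi> _ pq] by blast
    then have "(\<integral>\<^sup>+x. ennreal (norm (\<phi> x) * norm (indicator (A i) (T x) :: real)) \<partial>M) < \<infinity>"
      by (subst nn_integral_eq_integral) auto
    moreover have "ennreal (norm (\<phi> x) * norm (indicator (A i) (T x) :: real))
        = ennreal (\<phi> x) * indicator (A i) (T x)" for x
      using nonneg by (auto simp: indicator_def)
    ultimately show "(\<integral>\<^sup>+x. u x * indicator (A i) x \<partial>M) \<noteq> \<infinity>"
      by (subst dual) (auto simp: less_top)
  qed
  then have "AE x in M. \<forall>i. u x * indicator (A i) x \<noteq> \<infinity>" by (simp add: AE_all_countable)
  then have fin: "AE x in M. u x \<noteq> \<infinity>"
  proof (rule AE_mp, intro AE_I2 impI)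
    fix x assume "x \<in> space M" and *: "\<forall>i. u x * indicator (A i) x \<noteq> \<infinity>"
    then obtain i where "x \<in> A i" using A by blast
    then show "u x \<noteq> \<infinity>" using *[rule_format, of i] by simp
  qed
  have "density M (\<lambda>x. ennreal (enn2real (u x))) = density M u"
    using fin by (intro density_cong) (auto simp: less_top)
  then show thesis using dens by (intro that[of "\<lambda>x. enn2real (u x)"]) auto
qed

text \<open>
  The transfer operator is a contraction of every \<open>L\<^sup>p\<close>.  For \<open>p = \<infinity>\<close> the density cannot exceed
  the bound \<open>C\<close> on a set of positive measure, by invariance of the measure.  For finite \<open>p = r\<close>
  the duality relation is tested against the power \<open>r - 1\<close> of a truncation \<open>w\<close> of \<open>v\<close>; since
  \<open>w\<^sup>r \<le> v w\<^sup>r\<^sup>-\<^sup>1\<close>, the tangent inequality and invariance give \<open>\<integral> w\<^sup>r \<le> \<integral> \<phi>\<^sup>r\<close>, and the truncation is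
  removed by Fatou's lemma.
\<close>

lemma (in sigma_finite_measure) nonneg_transfer_density_Lp:
  fixes \<phi> v :: "'a \<Rightarrow> real"
  assumes T: "measure_preserving_map M T" and p: "1 \<le> p"
    and \<phi>: "\<phi> \<in> Lp M p" and nonneg: "\<And>x. 0 \<le> \<phi> x"
    and v[measurable]: "v \<in> borel_measurable M" and v_nonneg: "\<And>x. 0 \<le> v x"
    and dens: "density M v = distr (density M \<phi>) M T"
  shows "v \<in> Lp M p"
proof -
  have T_meas[measurable]: "T \<in> measurable M M" 
    using T by (auto simp: measure_preserving_map_def)
  note [measurable] = Lp_measurable[OF \<phi>]
  note dual = nonneg_transfer_duality[OF T Lp_measurable[OF \<phi>] v dens]
  obtain A :: "nat \<Rightarrow> 'a set" where A: "range A \<subseteq> sets M" "(\<Union>i. A i) = space M"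
    "\<And>i. emeasure M (A i) \<noteq> \<infinity>" "incseq A"
    using sigma_finite_incseq by blast
  have A_meas[measurable]: "A i \<in> sets M" for i using A by auto
  show ?thesis
  proof (cases "p = \<infinity>")
    case True
    then obtain C' :: real where "AE x in M. norm (\<phi> x) \<le> C'" using \<phi> by (auto simp: Lp_def)
    define C where "C = max C' 0"
    have C: "C \<ge> 0" "AE x in M. \<phi> x \<le> C"
      using \<open>AE x in M. norm (\<phi> x) \<le> C'\<close> by (auto simp: C_def elim: eventually_mono)
    \<comment> \<open>Cutting down to \<open>A i\<close> keeps the integrals finite, so that they can be cancelled.\<close>
    have bound: "AE x in M. x \<in> A i \<longrightarrow> v x \<le> C" for i
    proof -
      let ?E = "{x\<in>space M. x \<in> A i \<and> C < v x}"
      have [measurable]: "?E \<in> sets M" by measurable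
      have "emeasure M ?E \<le> emeasure M (A i)" by (intro emeasure_mono) auto
      then have E_fin: "emeasure M ?E < \<infinity>" using A(3)[of i] by (auto simp: less_top top_unique)
      have "(\<integral>\<^sup>+x. ennreal C * indicator ?E x \<partial>M) + (\<integral>\<^sup>+x. ennreal (v x - C) * indicator ?E x \<partial>M)
          = (\<integral>\<^sup>+x. ennreal C * indicator ?E x + ennreal (v x - C) * indicator ?E x \<partial>M)"
        by (subst nn_integral_add) auto
      also have "\<dots> = (\<integral>\<^sup>+x. ennreal (v x) * indicator ?E x \<partial>M)"
        using C by (intro nn_integral_cong)
          (auto simp: indicator_def ennreal_plus[symmetric] simp del: ennreal_plus)
      also have "\<dots> = (\<integral>\<^sup>+x. ennreal (\<phi> x) * indicator ?E (T x) \<partial>M)" by (rule dual) auto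
      also have "\<dots> \<le> (\<integral>\<^sup>+x. ennreal C * indicator ?E (T x) \<partial>M)"
        using C(2) by (intro nn_integral_mono_AE) (auto simp: indicator_def elim!: eventually_mono intro: ennreal_leI)
      also have "\<dots> = (\<integral>\<^sup>+x. ennreal C * indicator ?E x \<partial>M)"
        by (rule nn_integral_measure_preserving[OF T, of "\<lambda>x. ennreal C * indicator ?E x"]) auto
      finally have "(\<integral>\<^sup>+x. ennreal (v x - C) * indicator ?E x \<partial>M) \<le> 0"
        using ennreal_add_left_cancel_le[of "\<integral>\<^sup>+x. ennreal C * indicator ?E x \<partial>M" _ 0] E_fin
        by (auto simp: nn_integral_cmult_indicator ennreal_mult_eq_top_iff)
      then have "AE x in M. ennreal (v x - C) * indicator ?E x = 0"
        by (subst (asm) le_zero_eq, subst (asm) nn_integral_0_iff_AE) auto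
      then show ?thesis
      proof (rule AE_mp, intro AE_I2 impI)
        fix x assume "x \<in> space M" "x \<in> A i" "ennreal (v x - C) * indicator ?E x = 0"
        then show "v x \<le> C" by (cases "C < v x") (auto simp: ennreal_eq_0_iff)
      qed
    qed
    then have "AE x in M. \<forall>i. x \<in> A i \<longrightarrow> v x \<le> C"
      by (subst AE_all_countable) blast
    then have "AE x in M. norm (v x) \<le> C"
      by (rule AE_mp, intro AE_I2 impI) (use A(2) v_nonneg in auto)
    then show ?thesis using True by (auto simp: Lp_def)
  next
    case False
    then obtain r where r: "p = ennreal r" "r \<ge> 0" by (metis ennreal_cases infinity_ennreal_def)
    have r1: "r \<ge> 1" using p r by (metis ennreal_1 ennreal_le_iff)
    define w where "w n x = indicator (A n) x * min (v x) (real n)" for n x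
    have w_meas[measurable]: "w n \<in> borel_measurable M" for n unfolding w_def by measurable
    have w_nonneg: "0 \<le> w n x" and w_le: "w n x \<le> v x" for n x
      using v_nonneg by (auto simp: w_def indicator_def)
    have \<phi>_int: "(\<integral>\<^sup>+x. ennreal (\<phi> x powr r) \<partial>M) < \<infinity>"
      using \<phi> nonneg r False by (simp add: Lp_def nn_integral_eq_integral)
    have w_bound: "(\<integral>\<^sup>+x. ennreal (w n x powr r) \<partial>M) \<le> (\<integral>\<^sup>+x. ennreal (\<phi> x powr r) \<partial>M)" for n
    proof -
      let ?I = "\<integral>\<^sup>+x. ennreal (w n x powr r) \<partial>M"
      have "?I \<le> (\<integral>\<^sup>+x. ennreal (real n powr r) * indicator (A n) x \<partial>M)"
        using v_nonneg r by (intro nn_integral_mono)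
          (auto simp: w_def indicator_def intro!: ennreal_leI powr_mono2)
      also have "\<dots> < \<infinity>"
        using A(3)[of n] by (simp add: nn_integral_cmult_indicator ennreal_mult_less_top less_top)
      finally have I_fin: "?I < \<infinity>" .
      have pow: "w n x powr r \<le> v x * w n x powr (r - 1)" for x
      proof -
        have "w n x powr r = w n x * w n x powr (r - 1)"
          using w_nonneg[of n x] by (simp add: powr_mult_base)
        then show ?thesis using w_le by (simp add: mult_right_mono)
      qed
      have "ennreal r * ?I \<le> ennreal r * (\<integral>\<^sup>+x. ennreal (v x) * ennreal (w n x powr (r - 1)) \<partial>M)"
        using pow v_nonneg by (intro mult_left_mono nn_integral_mono)
          (auto simp: ennreal_mult[symmetric] intro: ennreal_leI)
      also have "\<dots> = ennreal r * (\<integral>\<^sup>+x. ennreal (\<phi> x) * ennreal (w n (T x) powr (r - 1)) \<partial>M)"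
        by (subst dual) auto
      also have "\<dots> = (\<integral>\<^sup>+x. ennreal (r * (\<phi> x * w n (T x) powr (r - 1))) \<partial>M)"
        using nonneg r by (subst nn_integral_cmult[symmetric]) (auto simp: ennreal_mult)
      also have "\<dots> \<le> (\<integral>\<^sup>+x. ennreal (\<phi> x powr r) + ennreal (r - 1) * ennreal (w n (T x) powr r) \<partial>M)"
        using power_tangent_inequality[OF r1 nonneg w_nonneg] r1
        by (intro nn_integral_mono)
          (auto simp: ennreal_mult[symmetric] ennreal_plus[symmetric] simp del: ennreal_plus intro!: ennreal_leI)
      also have "\<dots> = (\<integral>\<^sup>+x. ennreal (\<phi> x powr r) \<partial>M) + ennreal (r - 1) * (\<integral>\<^sup>+x. ennreal (w n (T x) powr r) \<partial>M)"
        by (simp add: nn_integral_add nn_integral_cmult)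
      also have "(\<integral>\<^sup>+x. ennreal (w n (T x) powr r) \<partial>M) = ?I"
        by (rule nn_integral_measure_preserving[OF T, of "\<lambda>x. ennreal (w n x powr r)"]) auto
      finally have "ennreal r * ?I \<le> (\<integral>\<^sup>+x. ennreal (\<phi> x powr r) \<partial>M) + ennreal (r - 1) * ?I" .
      moreover have "ennreal r * ?I = ?I + ennreal (r - 1) * ?I"
      proof -
        have "ennreal r = 1 + ennreal (r - 1)"
          using r1 by (simp add: ennreal_plus[symmetric] ennreal_1[symmetric] del: ennreal_plus ennreal_1)
        then show ?thesis by (simp add: distrib_right)
      qed
      ultimately show ?thesis
        using I_fin by (auto simp: add.commute[of _ "ennreal (r - 1) * _"] ennreal_mult_eq_top_iff
            ennreal_add_left_cancel_le)
    qed
    have lim: "(\<lambda>n. w n x powr r) \<longlonglongrightarrow> v x powr r" if x: "x \<in> space M" for x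
    proof -
      obtain i where i: "x \<in> A i" using A x by blast
      obtain k where k: "v x \<le> real k" using real_arch_simple by blast
      have "w n x = v x" if "n \<ge> max i k" for n
        using that i k incseqD[OF A(4), of i n] by (auto simp: w_def)
      then have "\<forall>\<^sub>F n in sequentially. w n x powr r = v x powr r"
        by (auto simp: eventually_sequentially intro!: exI[of _ "max i k"])
      then show ?thesis by (rule tendsto_eventually)
    qed
    have "(\<integral>\<^sup>+x. ennreal (v x powr r) \<partial>M) = (\<integral>\<^sup>+x. liminf (\<lambda>n. ennreal (w n x powr r)) \<partial>M)"
      using lim by (intro nn_integral_cong lim_imp_Liminf[symmetric] tendsto_ennrealI) auto
    also have "\<dots> \<le> liminf (\<lambda>n. \<integral>\<^sup>+x. ennreal (w n x powr r) \<partial>M)"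
      by (intro nn_integral_liminf) auto
    also have "\<dots> \<le> (\<integral>\<^sup>+x. ennreal (\<phi> x powr r) \<partial>M)"
      by (rule Liminf_le) (auto simp: w_bound)
    finally have "(\<integral>\<^sup>+x. ennreal (v x powr r) \<partial>M) < \<infinity>" using \<phi>_int by (rule le_less_trans)
    then have "integrable M (\<lambda>x. v x powr r)" by (intro integrableI_bounded) auto
    then show ?thesis using r v_nonneg False by (simp add: Lp_def)
  qed
qed

text \<open>The relation from which \<^const>\<open>transfer_operator\<close> selects a member of \<open>L\<^sup>p\<close>.\<close>

definition transfer_dual ::
  "'a measure \<Rightarrow> ('a \<Rightarrow> 'a) \<Rightarrow> ennreal \<Rightarrow> ('a \<Rightarrow> 'k::{real_normed_field, euclidean_space}) \<Rightarrow> ('a \<Rightarrow> 'k) \<Rightarrow> bool"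
  where
  "transfer_dual M T p f u \<longleftrightarrow> (\<forall>q. 1 / p + 1 / q = 1 \<longrightarrow>
     (\<forall>h\<in>Lp M q. (\<integral>x. u x * h x \<partial>M) = (\<integral>x. f x * h (T x) \<partial>M)))"

text \<open>
  Both sides are integrals of \<open>h\<close> against one and the same measure, and this is what extends the
  relation from nonnegative to scalar-valued measurable \<open>h\<close>.
\<close>

lemma (in sigma_finite_measure) nonneg_transfer_dual_exists:
  fixes \<phi> :: "'a \<Rightarrow> real"
  assumes T: "measure_preserving_map M T" and p: "1 \<le> p"
    and \<phi>: "\<phi> \<in> Lp M p" and nonneg: "\<And>x. 0 \<le> \<phi> x"
  shows "\<exists>v::'a \<Rightarrow> real. v \<in> Lp M p \<and> (\<forall>h::'a \<Rightarrow> 'k::{real_normed_field, euclidean_space}.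
     h \<in> borel_measurable M \<longrightarrow> (\<integral>x. v x *\<^sub>R h x \<partial>M) = (\<integral>x. \<phi> x *\<^sub>R h (T x) \<partial>M))"
proof -
  have T_meas[measurable]: "T \<in> measurable M M"
    using T by (auto simp: measure_preserving_map_def)
  note [measurable] = Lp_measurable[OF \<phi>]
  obtain v :: "'a \<Rightarrow> real" where v[measurable]: "v \<in> borel_measurable M" and v_nonneg: "\<And>x. 0 \<le> v x"
    and dens: "density M v = distr (density M \<phi>) M T"
    using nonneg_transfer_density_exists[OF assms] by blast
  have "(\<integral>x. v x *\<^sub>R h x \<partial>M) = (\<integral>x. \<phi> x *\<^sub>R h (T x) \<partial>M)"
    if h[measurable]: "h \<in> borel_measurable M" for h :: "'a \<Rightarrow> 'k"
  proof -
    have "(\<integral>x. v x *\<^sub>R h x \<partial>M) = (\<integral>x. h x \<partial>density M v)"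
      using v_nonneg by (subst integral_density) auto
    also have "\<dots> = (\<integral>x. h (T x) \<partial>density M \<phi>)"
      unfolding dens by (subst integral_distr) auto
    also have "\<dots> = (\<integral>x. \<phi> x *\<^sub>R h (T x) \<partial>M)"
      using nonneg by (subst integral_density) auto
    finally show ?thesis .
  qed
  then show ?thesis
    by (intro exI[of _ v] conjI allI impI nonneg_transfer_density_Lp[OF assms v v_nonneg dens]) blast
qed

text \<open>
  The function \<open>f\<close> is split into the positive and negative parts of its coordinates, whose
  transfers are recombined.  Each basis vector is absorbed into the test function as a factor.
\<close>

lemma (in sigma_finite_measure) transfer_dual_exists:
  fixes f :: "'a \<Rightarrow> 'k::{real_normed_field, euclidean_space}"
  assumes T: "measure_preserving_map M T" and p: "1 \<le> p" and f: "f \<in> Lp M p"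
  obtains u where "u \<in> Lp M p" "transfer_dual M T p f u"
proof -
  have T_meas[measurable]: "T \<in> measurable M M"
    using T by (auto simp: measure_preserving_map_def)
  note [measurable] = Lp_measurable[OF f]
  define pos where "pos b x = max 0 (f x \<bullet> b)" for b x
  define neg where "neg b x = max 0 (- (f x \<bullet> b))" for b x
  have pos_Lp: "pos b \<in> Lp M p" and neg_Lp: "neg b \<in> Lp M p" if "b \<in> Basis" for b
    using Basis_le_norm[OF that, of "f _"]
    by (auto simp: pos_def[abs_def] neg_def[abs_def] abs_le_iff intro!: Lp_dominated[OF f])
  have pos_nonneg: "0 \<le> pos b x" and neg_nonneg: "0 \<le> neg b x" for b x
    by (auto simp: pos_def neg_def)
  have f_eq: "f x = (\<Sum>b\<in>Basis. pos b x *\<^sub>R b - neg b x *\<^sub>R b)" for x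
  proof -
    have "pos b x *\<^sub>R b - neg b x *\<^sub>R b = (f x \<bullet> b) *\<^sub>R b" for b
      by (auto simp: pos_def neg_def max_def)
    then show ?thesis by (simp add: euclidean_representation)
  qed
  have "\<forall>b. b \<in> Basis \<longrightarrow> (\<exists>v::'a \<Rightarrow> real. v \<in> Lp M p \<and> (\<forall>h::'a \<Rightarrow> 'k. h \<in> borel_measurable M \<longrightarrow>
      (\<integral>x. v x *\<^sub>R h x \<partial>M) = (\<integral>x. pos b x *\<^sub>R h (T x) \<partial>M)))"
    using nonneg_transfer_dual_exists[OF T p pos_Lp] pos_nonneg by blast
  then obtain V where V: "\<And>b. b \<in> Basis \<Longrightarrow> V b \<in> Lp M p"
    and V_dual: "\<And>b (h::'a \<Rightarrow> 'k). b \<in> Basis \<Longrightarrow> h \<in> borel_measurable M \<Longrightarrow>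
      (\<integral>x. V b x *\<^sub>R h x \<partial>M) = (\<integral>x. pos b x *\<^sub>R h (T x) \<partial>M)"
    by metis
  have "\<forall>b. b \<in> Basis \<longrightarrow> (\<exists>v::'a \<Rightarrow> real. v \<in> Lp M p \<and> (\<forall>h::'a \<Rightarrow> 'k. h \<in> borel_measurable M \<longrightarrow>
      (\<integral>x. v x *\<^sub>R h x \<partial>M) = (\<integral>x. neg b x *\<^sub>R h (T x) \<partial>M)))"
    using nonneg_transfer_dual_exists[OF T p neg_Lp] neg_nonneg by blast
  then obtain W where W: "\<And>b. b \<in> Basis \<Longrightarrow> W b \<in> Lp M p"
    and W_dual: "\<And>b (h::'a \<Rightarrow> 'k). b \<in> Basis \<Longrightarrow> h \<in> borel_measurable M \<Longrightarrow>
      (\<integral>x. W b x *\<^sub>R h x \<partial>M) = (\<integral>x. neg b x *\<^sub>R h (T x) \<partial>M)"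
    by metis
  define u where "u x = (\<Sum>b\<in>Basis. V b x *\<^sub>R b + (- W b x) *\<^sub>R b)" for x
  have scaled: "(\<lambda>x. a x *\<^sub>R (b::'k)) \<in> Lp M p" if "b \<in> Basis" "a \<in> Lp M p" for a :: "'a \<Rightarrow> real" and b
    using that Lp_measurable[OF that(2)] by (intro Lp_dominated[OF that(2)]) auto
  have minus: "(\<lambda>x. - a x) \<in> Lp M p" if "a \<in> Lp M p" for a :: "'a \<Rightarrow> real"
    using Lp_measurable[OF that] by (intro Lp_dominated[OF that]) auto
  have "u \<in> Lp M p"
    unfolding u_def[abs_def] by (intro Lp_sum Lp_add scaled minus V W)
  moreover have "(\<integral>x. u x * h x \<partial>M) = (\<integral>x. f x * h (T x) \<partial>M)"
    if pq: "1 / p + 1 / q = 1" and h: "h \<in> Lp M q" for q h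
  proof -
    note [measurable] = Lp_measurable[OF h]
    have int: "integrable M (\<lambda>x. a x *\<^sub>R (b * k x))"
      if a: "a \<in> Lp M p" and k: "k \<in> Lp M q" for a :: "'a \<Rightarrow> real" and b :: 'k and k
    proof -
      note [measurable] = Lp_measurable[OF a] Lp_measurable[OF k]
      have "integrable M (\<lambda>x. norm b * (norm (a x) * norm (k x)))"
        using Lp_product_integrable[OF a k pq] by (rule integrable_mult_right)
      then show ?thesis by (rule Bochner_Integration.integrable_bound) (auto simp: norm_mult mult_ac)
    qed
    have hT: "(\<lambda>x. h (T x)) \<in> Lp M q" using Lp_compose[OF T h] .
    have "(\<integral>x. u x * h x \<partial>M)
        = (\<integral>x. (\<Sum>b\<in>Basis. V b x *\<^sub>R (b * h x) - W b x *\<^sub>R (b * h x)) \<partial>M)"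
      by (simp add: u_def sum_distrib_right left_diff_distrib)
    also have "\<dots> = (\<Sum>b\<in>Basis. (\<integral>x. V b x *\<^sub>R (b * h x) \<partial>M) - (\<integral>x. W b x *\<^sub>R (b * h x) \<partial>M))"
      using int[OF V h] int[OF W h] by (simp add: Bochner_Integration.integral_sum)
    also have "\<dots> = (\<Sum>b\<in>Basis. (\<integral>x. pos b x *\<^sub>R (b * h (T x)) \<partial>M)
        - (\<integral>x. neg b x *\<^sub>R (b * h (T x)) \<partial>M))"
      using V_dual[of _ "\<lambda>x. _ * h x"] W_dual[of _ "\<lambda>x. _ * h x"]
      by (intro sum.cong refl arg_cong2[of _ _ _ _ "(-)"]) auto
    also have "\<dots> = (\<integral>x. (\<Sum>b\<in>Basis. pos b x *\<^sub>R (b * h (T x)) - neg b x *\<^sub>R (b * h (T x))) \<partial>M)"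
      using int[OF pos_Lp hT] int[OF neg_Lp hT] by (simp add: Bochner_Integration.integral_sum)
    also have "\<dots> = (\<integral>x. f x * h (T x) \<partial>M)"
      by (subst f_eq) (simp add: sum_distrib_right left_diff_distrib)
    finally show ?thesis .
  qed
  ultimately show thesis by (intro that[of u]) (auto simp: transfer_dual_def)
qed

text \<open>Indicators of sets of finite measure are admissible test functions for every exponent.\<close>

lemma (in sigma_finite_measure) transfer_dual_unique:
  fixes f u v :: "'a \<Rightarrow> 'k::{real_normed_field, euclidean_space}"
  assumes p: "1 \<le> p" and u: "u \<in> Lp M p" and v: "v \<in> Lp M p"
    and u_dual: "transfer_dual M T p f u" and v_dual: "transfer_dual M T p f v"
  shows "AE x in M. u x = v x"
proof -
  note [measurable] = Lp_measurable[OF u] Lp_measurable[OF v]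
  obtain q where pq: "1 / p + 1 / q = 1" using conjugate_exponent_exists[OF p] .
  obtain A :: "nat \<Rightarrow> 'a set" where A: "range A \<subseteq> sets M" "(\<Union>i. A i) = space M"
    "\<And>i. emeasure M (A i) \<noteq> \<infinity>"
    using sigma_finite by blast
  have A_meas[measurable]: "A i \<in> sets M" for i using A by auto
  have ind: "(indicator E :: 'a \<Rightarrow> 'k) \<in> Lp M q" if "E \<in> sets M" "E \<subseteq> A i" for E i
  proof (rule Lp_indicator)
    have "emeasure M E \<le> emeasure M (A i)" using that by (intro emeasure_mono) auto
    then show "emeasure M E < \<infinity>" using A(3)[of i] by (auto simp: less_top top_unique)
  qed fact
  have mult_ind: "a * indicator E x = indicator E x *\<^sub>R a" for a :: 'k and E :: "'a set" and x
    by (simp add: indicator_def)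
  have "AE x in M. indicator (A i) x *\<^sub>R u x = indicator (A i) x *\<^sub>R v x" for i
  proof (rule density_unique_banach)
    show "integrable M (\<lambda>x. indicator (A i) x *\<^sub>R u x)" "integrable M (\<lambda>x. indicator (A i) x *\<^sub>R v x)"
      using Lp_times_integrable[OF u ind[of "A i" i] pq] Lp_times_integrable[OF v ind[of "A i" i] pq]
      by (auto simp: mult_ind)
    fix E assume E[measurable]: "E \<in> sets M"
    have "(\<integral>x. u x * indicator (E \<inter> A i) x \<partial>M) = (\<integral>x. v x * indicator (E \<inter> A i) x \<partial>M)"
      using u_dual v_dual pq ind[of "E \<inter> A i" i] by (simp add: transfer_dual_def)
    then show "(LINT x:E|M. indicator (A i) x *\<^sub>R u x) = (LINT x:E|M. indicator (A i) x *\<^sub>R v x)"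
      by (simp add: set_lebesgue_integral_def mult_ind indicator_inter_arith mult.commute)
  qed
  then have "AE x in M. \<forall>i. indicator (A i) x *\<^sub>R u x = indicator (A i) x *\<^sub>R v x"
    by (subst AE_all_countable) blast
  then show ?thesis
  proof (rule AE_mp, intro AE_I2 impI)
    fix x assume "x \<in> space M" and *: "\<forall>i. indicator (A i) x *\<^sub>R u x = indicator (A i) x *\<^sub>R v x"
    then obtain i where "x \<in> A i" using A by blast
    then show "u x = v x" using *[rule_format, of i] by simp
  qed
qed

lemma (in sigma_finite_measure) transfer_operator_eqI:
  fixes f u :: "'a \<Rightarrow> 'k::{real_normed_field, euclidean_space}"
  assumes p: "1 \<le> p" and u: "u \<in> Lp M p" "transfer_dual M T p f u"
  shows "AE x in M. transfer_operator M T p f x = u x"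
proof -
  have "transfer_operator M T p f \<in> Lp M p \<and> transfer_dual M T p f (transfer_operator M T p f)"
    unfolding transfer_operator_def transfer_dual_def[symmetric]
    by (rule someI[of _ u]) (use u in simp)
  then show ?thesis using transfer_dual_unique[OF p _ u(1) _ u(2)] by blast
qed

section \<open>Hitting times and the induced map\<close>

lemma hitting_time_eq_enat_iff:
  "hitting_time T B x = enat n \<longleftrightarrow> 1 \<le> n \<and> (T ^^ n) x \<in> B \<and> (\<forall>j. 1 \<le> j \<and> j < n \<longrightarrow> (T ^^ j) x \<notin> B)"
proof (cases "\<exists>n. 1 \<le> n \<and> (T ^^ n) x \<in> B")
  case True
  define k where "k = (LEAST n. 1 \<le> n \<and> (T ^^ n) x \<in> B)"
  have k: "1 \<le> k \<and> (T ^^ k) x \<in> B" unfolding k_def using True by (rule LeastI_ex)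
  have least: "k \<le> n" if "1 \<le> n \<and> (T ^^ n) x \<in> B" for n
    unfolding k_def using that by (rule Least_le)
  have "hitting_time T B x = enat k"
    unfolding hitting_time_def using k least by (intro antisym Inf_lower Inf_greatest) auto
  then show ?thesis
    using k least by (auto simp: not_less[symmetric]) (metis linorder_neqE_nat)
next
  case False
  then have none: "\<not> (1 \<le> n \<and> (T ^^ n) x \<in> B)" for n by blast
  then have "hitting_time T B x = \<infinity>"
    unfolding hitting_time_def by (auto simp: Inf_enat_def)
  then show ?thesis using none[of n] by auto
qed

lemma hitting_time_finite_iff: "hitting_time T B x \<noteq> \<infinity> \<longleftrightarrow> (\<exists>n\<ge>1. (T ^^ n) x \<in> B)"
proof
  assume "hitting_time T B x \<noteq> \<infinity>"
  then obtain n where "hitting_time T B x = enat n" by auto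
  then show "\<exists>n\<ge>1. (T ^^ n) x \<in> B" by (auto simp: hitting_time_eq_enat_iff)
next
  assume "\<exists>n\<ge>1. (T ^^ n) x \<in> B"
  then obtain n where "1 \<le> n" "(T ^^ n) x \<in> B" by blast
  then have "hitting_time T B x \<le> enat n" unfolding hitting_time_def by (intro Inf_lower) auto
  then show "hitting_time T B x \<noteq> \<infinity>" by (cases "hitting_time T B x") auto
qed

lemma hitting_time_eq_one_iff: "hitting_time T B x = enat (Suc 0) \<longleftrightarrow> T x \<in> B"
  by (auto simp: hitting_time_eq_enat_iff)

lemma hitting_time_eq_Suc_Suc_iff:
  "hitting_time T B x = enat (Suc (Suc n)) \<longleftrightarrow> T x \<notin> B \<and> hitting_time T B (T x) = enat (Suc n)"
proof -
  have "(\<forall>j. 1 \<le> j \<and> j < Suc (Suc n) \<longrightarrow> (T ^^ j) x \<notin> B) \<longleftrightarrow>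
      T x \<notin> B \<and> (\<forall>j. 1 \<le> j \<and> j < Suc n \<longrightarrow> (T ^^ j) (T x) \<notin> B)" (is "?L \<longleftrightarrow> ?R")
  proof
    assume ?L
    then show ?R by (auto simp flip: funpow_Suc_right[unfolded o_def, THEN fun_cong] 
          dest: spec[of _ 1] spec[of _ "Suc _"])
  next
    assume R: ?R
    show ?L
    proof (intro allI impI)
      fix j assume j: "1 \<le> j \<and> j < Suc (Suc n)"
      then obtain i where i: "j = Suc i" by (cases j) auto
      show "(T ^^ j) x \<notin> B" using R j i by (cases i) (auto simp: funpow_swap1)
    qed
  qed
  then show ?thesis by (auto simp: hitting_time_eq_enat_iff funpow_swap1)
qed

lemma hitting_time_le_Suc_iff:
  "hitting_time T B x \<le> enat (Suc n) \<longleftrightarrow> hitting_time T B x \<le> enat n \<or> hitting_time T B x = enat (Suc n)"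
  by (cases "hitting_time T B x") auto

lemma hitting_time_not_le_zero: "\<not> hitting_time T B x \<le> enat 0"
  using hitting_time_eq_enat_iff[of T B x 0] by (auto simp: zero_enat_def[symmetric])

lemma induced_map_eq: "hitting_time T B x = enat n \<Longrightarrow> induced_map T B x = (T ^^ n) x"
  by (simp add: induced_map_def)

lemma induced_map_in: "x \<in> B \<Longrightarrow> induced_map T B x \<in> B"
  by (cases "hitting_time T B x")
    (auto simp: induced_map_def hitting_time_eq_enat_iff[THEN iffD1])

locale recurrent_system = sigma_finite_measure M for M :: "'a measure" +
  fixes T :: "'a \<Rightarrow> 'a"
  assumes preserving: "measure_preserving_map M T" and recurrence: "recurrent M T"
begin

lemma T_measurable[measurable]: "T \<in> measurable M M"
  using preserving by (simp add: measure_preserving_map_def)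

lemma funpow_measurable[measurable]: "T ^^ n \<in> measurable M M"
  by (induction n) (auto intro: measurable_comp)

lemma preserving_funpow: "measure_preserving_map M (T ^^ n)"
proof (induction n)
  case (Suc n)
  have "distr M M (T \<circ> T ^^ n) = distr (distr M M (T ^^ n)) M T"
    by (subst distr_distr) auto
  with Suc preserving show ?case by (simp add: measure_preserving_map_def comp_def)
qed (simp add: measure_preserving_map_def distr_id id_def)

lemma hitting_time_measurable:
  assumes [measurable]: "B \<in> sets M"
  shows "hitting_time T B \<in> measurable M (count_space UNIV)"
proof -
  have "hitting_time T B -` {k} \<inter> space M \<in> sets M" for k
  proof (cases k)
    case (enat n)
    then have "hitting_time T B -` {k} \<inter> space M
        = {x\<in>space M. 1 \<le> n \<and> (T ^^ n) x \<in> B \<and> (\<forall>j. 1 \<le> j \<and> j < n \<longrightarrow> (T ^^ j) x \<notin> B)}"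
      by (auto simp: hitting_time_eq_enat_iff)
    then show ?thesis by simp
  next
    case infinity
    then have "hitting_time T B -` {k} \<inter> space M
        = {x\<in>space M. \<not> (\<exists>n. 1 \<le> n \<and> (T ^^ n) x \<in> B)}"
      using hitting_time_finite_iff[of T B] by blast
    then show ?thesis by simp
  qed
  then show ?thesis by (subst measurable_count_space_eq_countable) auto
qed

lemma hitting_time_pred_measurable[measurable]:
  assumes "B \<in> sets M"
  shows "Measurable.pred M (\<lambda>x. hitting_time T B x = k)"
    and "Measurable.pred M (\<lambda>x. hitting_time T B x \<le> k)"
  by (rule measurable_compose[OF hitting_time_measurable[OF assms]], simp)+

lemma induced_map_measurable[measurable]:
  assumes "B \<in> sets M"
  shows "induced_map T B \<in> measurable M M"
  unfolding induced_map_def[abs_def]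
  by (rule measurable_case_enat[OF hitting_time_measurable[OF assms]]) auto

lemma AE_hitting_time_finite:
  assumes B: "B \<in> sets M"
  shows "AE x in M. x \<in> B \<longrightarrow> hitting_time T B x \<noteq> \<infinity>"
proof (cases "emeasure M B = 0")
  case True
  then have "AE x in M. x \<notin> B" using B by (intro AE_not_in) auto
  then show ?thesis by eventually_elim auto
next
  case False
  then show ?thesis
    using recurrence B unfolding recurrent_def hitting_time_finite_iff by (auto simp: zero_less_iff_neq_zero)
qed

section \<open>Decomposition according to the first return\<close>

text \<open>
  \<open>entrance_integral B H n\<close> weighs the points of the whole space, not only of \<open>B\<close>, whose orbit first
  enters \<open>B\<close> at time \<open>n\<close>, and \<open>return_integral B H n\<close> weighs the points
  of \<open>B\<close> that have returned by time \<open>n\<close>, in both cases by the value of \<open>H\<close> at the point of entrance.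
\<close>

definition entrance_integral :: "'a set \<Rightarrow> ('a \<Rightarrow> ennreal) \<Rightarrow> nat \<Rightarrow> ennreal" where
  "entrance_integral B H n = (\<integral>\<^sup>+x. (if hitting_time T B x = enat n then H ((T ^^ n) x) else 0) \<partial>M)"

definition return_integral :: "'a set \<Rightarrow> ('a \<Rightarrow> ennreal) \<Rightarrow> nat \<Rightarrow> ennreal" where
  "return_integral B H n =
     (\<integral>\<^sup>+x. (if x \<in> B \<and> hitting_time T B x \<le> enat n then H (induced_map T B x) else 0) \<partial>M)"

text \<open>
  A point entering \<open>B\<close> at time \<open>n\<close> either starts in \<open>B\<close>, and then it is a return, or outside.  The
  preimages under \<open>T\<close> of the points of the second kind are exactly the points entering at time
  \<open>n + 1\<close>, so by invariance these two sets carry the same integral.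
\<close>

lemma first_return_decomposition:
  assumes B[measurable]: "B \<in> sets M" and H[measurable]: "H \<in> borel_measurable M"
  shows "(\<integral>\<^sup>+x. H x * indicator B x \<partial>M) = return_integral B H n + entrance_integral B H (Suc n)"
proof (induction n)
  case 0
  have "(\<integral>\<^sup>+x. H x * indicator B x \<partial>M) = (\<integral>\<^sup>+x. H (T x) * indicator B (T x) \<partial>M)"
    by (rule nn_integral_measure_preserving[OF preserving, symmetric]) measurable
  also have "\<dots> = entrance_integral B H (Suc 0)"
    unfolding entrance_integral_def
    by (intro nn_integral_cong) (auto simp: hitting_time_eq_one_iff indicator_def)
  also have "return_integral B H 0 = 0"
    by (simp add: return_integral_def hitting_time_not_le_zero)
  ultimately show ?case by simp
next
  case (Suc n)
  let ?C = "\<integral>\<^sup>+x. (if x \<in> B \<and> hitting_time T B x = enat (Suc n) then H (induced_map T B x) else 0) \<partial>M"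
  let ?k = "\<lambda>x. if x \<notin> B \<and> hitting_time T B x = enat (Suc n) then H ((T ^^ Suc n) x) else 0"
  have [measurable]: "?k \<in> borel_measurable M" by measurable
  have "entrance_integral B H (Suc n) = ?C + (\<integral>\<^sup>+x. ?k x \<partial>M)"
    unfolding entrance_integral_def
    by (subst nn_integral_add[symmetric]) (auto simp: induced_map_eq intro!: nn_integral_cong)
  also have "(\<integral>\<^sup>+x. ?k x \<partial>M) = (\<integral>\<^sup>+x. ?k (T x) \<partial>M)"
    by (rule nn_integral_measure_preserving[OF preserving, symmetric]) measurable
  also have "\<dots> = entrance_integral B H (Suc (Suc n))"
    unfolding entrance_integral_def
    by (intro nn_integral_cong) (auto simp: hitting_time_eq_Suc_Suc_iff funpow_swap1)
  finally have "entrance_integral B H (Suc n) = ?C + entrance_integral B H (Suc (Suc n))" .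
  moreover have "return_integral B H (Suc n) = return_integral B H n + ?C"
    unfolding return_integral_def
    by (subst nn_integral_add[symmetric])
      (auto simp: hitting_time_le_Suc_iff intro!: nn_integral_cong)
  ultimately show ?case using Suc by (simp add: add.assoc)
qed

lemma return_integral_tendsto:
  assumes B[measurable]: "B \<in> sets M" and H[measurable]: "H \<in> borel_measurable M"
  shows "return_integral B H \<longlonglongrightarrow> (\<integral>\<^sup>+x. H (induced_map T B x) * indicator B x \<partial>M)"
proof -
  let ?g = "\<lambda>n x. if x \<in> B \<and> hitting_time T B x \<le> enat n then H (induced_map T B x) else 0"
  have mono: "?g n x \<le> ?g (Suc n) x" for n x by (auto simp: hitting_time_le_Suc_iff)
  have "(\<integral>\<^sup>+x. H (induced_map T B x) * indicator B x \<partial>M) = (\<integral>\<^sup>+x. (SUP n. ?g n x) \<partial>M)"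
  proof (rule nn_integral_cong_AE, rule AE_mp[OF AE_hitting_time_finite[OF B]], intro AE_I2 impI)
    fix x assume fin: "x \<in> B \<longrightarrow> hitting_time T B x \<noteq> \<infinity>"
    show "H (induced_map T B x) * indicator B x = (SUP n. ?g n x)"
    proof (cases "x \<in> B")
      case True
      then obtain k where k: "hitting_time T B x = enat k" using fin by auto
      have "(SUP n. ?g n x) = H (induced_map T B x)"
      proof (rule antisym)
        show "H (induced_map T B x) \<le> (SUP n. ?g n x)"
          using True k by (intro SUP_upper2[of k]) auto
        show "(SUP n. ?g n x) \<le> H (induced_map T B x)" by (rule SUP_least) simp
      qed
      then show ?thesis using True by simp
    qed simp
  qed
  also have "\<dots> = (SUP n. \<integral>\<^sup>+x. ?g n x \<partial>M)"
    using mono by (intro nn_integral_monotone_convergence_SUP incseq_SucI le_funI) auto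
  also have "\<dots> = (SUP n. return_integral B H n)" by (simp add: return_integral_def)
  moreover have "incseq (return_integral B H)"
    unfolding return_integral_def using mono by (intro incseq_SucI nn_integral_mono) auto
  ultimately show ?thesis using LIMSEQ_SUP by metis
qed

lemma entrance_integral_tendsto_0_if_invariant:
  assumes B[measurable]: "B \<in> sets M" and H[measurable]: "H \<in> borel_measurable M"
    and fin: "(\<integral>\<^sup>+x. H x * indicator B x \<partial>M) < \<infinity>"
    and eq: "(\<integral>\<^sup>+x. H (induced_map T B x) * indicator B x \<partial>M) = (\<integral>\<^sup>+x. H x * indicator B x \<partial>M)"
  shows "(\<lambda>n. entrance_integral B H (Suc n)) \<longlonglongrightarrow> 0"
proof -
  let ?I = "\<integral>\<^sup>+x. H x * indicator B x \<partial>M"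
  have "entrance_integral B H (Suc n) = ?I - return_integral B H n" for n
  proof -
    have "return_integral B H n < \<infinity>"
      using fin first_return_decomposition[OF B H, of n] by (auto simp: less_top)
    then show ?thesis
      using first_return_decomposition[OF B H, of n] by (simp add: less_top)
  qed
  moreover have "(\<lambda>n. ?I - return_integral B H n) \<longlonglongrightarrow> ?I - ?I"
    using return_integral_tendsto[OF B H] fin unfolding eq
    by (intro tendsto_diff_ennreal_general tendsto_const) auto
  moreover have "?I - ?I = 0" using fin by (simp add: less_top)
  ultimately show ?thesis by (simp only:)
qed

text \<open>
  For \<open>B = E\<close> and the constant weight \<open>1\<close> the returns exhaust the finite mass of \<open>E\<close> by recurrence,
  so the entrance integrals of \<open>E\<close> tend to \<open>0\<close>.  An orbit whose first entrance into \<open>B\<close> happens in \<open>E\<close>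
  enters \<open>E\<close> for the first time at that moment; hence the entrance integrals of \<open>B\<close> weighted by \<open>E\<close>
  are dominated by those of \<open>E\<close>.  Passing to \<open>E\<close> is what covers sets \<open>B\<close> of infinite measure, in
  which one cannot compare \<open>E\<close> with its complement.
\<close>

lemma nn_integral_indicator_induced_map:
  assumes B[measurable]: "B \<in> sets M" and E[measurable]: "E \<in> sets M" and sub: "E \<subseteq> B"
    and fin: "emeasure M E < \<infinity>"
  shows "(\<integral>\<^sup>+x. indicator E (induced_map T B x) * indicator B x \<partial>M) = emeasure M E"
proof -
  have to_0: "(\<lambda>n. entrance_integral E (\<lambda>_. 1) (Suc n)) \<longlonglongrightarrow> 0"
    using fin by (intro entrance_integral_tendsto_0_if_invariant) auto
  have le: "entrance_integral B (indicator E) (Suc n) \<le> entrance_integral E (\<lambda>_. 1) (Suc n)" for n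
    unfolding entrance_integral_def
  proof (intro nn_integral_mono)
    fix x
    have "hitting_time T E x = enat (Suc n)"
      if "hitting_time T B x = enat (Suc n)" "(T ^^ Suc n) x \<in> E"
      using that sub unfolding hitting_time_eq_enat_iff by blast
    then show "(if hitting_time T B x = enat (Suc n) then indicator E ((T ^^ Suc n) x) else 0)
        \<le> (if hitting_time T E x = enat (Suc n) then 1 else 0 :: ennreal)"
      by (auto simp: indicator_def simp del: funpow.simps)
  qed
  have lim0: "(\<lambda>n. entrance_integral B (indicator E) (Suc n)) \<longlonglongrightarrow> 0"
    by (rule tendsto_sandwich[OF _ _ tendsto_const to_0]) (auto simp: le)
  have "(\<lambda>n. return_integral B (indicator E) n + entrance_integral B (indicator E) (Suc n))
      \<longlonglongrightarrow> (\<integral>\<^sup>+x. indicator E (induced_map T B x) * indicator B x \<partial>M) + 0"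
    by (intro tendsto_add return_integral_tendsto lim0) auto
  moreover have "return_integral B (indicator E) n + entrance_integral B (indicator E) (Suc n) = emeasure M E" for n
  proof -
    have "(\<integral>\<^sup>+x. indicator E x * indicator B x \<partial>M) = (\<integral>\<^sup>+x. indicator E x \<partial>M)"
      using sub by (intro nn_integral_cong) (auto simp: indicator_def)
    then show ?thesis using first_return_decomposition[of B "indicator E" n] by simp
  qed
  ultimately show ?thesis by (simp add: LIMSEQ_const_iff)
qed

lemma induced_map_measurable_restrict:
  assumes B: "B \<in> sets M"
  shows "induced_map T B \<in> measurable (restrict_space M B) (restrict_space M B)"
  using B sets.sets_into_space[OF B]
  by (intro measurable_restrict_space3 induced_map_measurable) (auto simp: induced_map_in)

lemma induced_map_preserving:
  assumes B[measurable]: "B \<in> sets M"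
  shows "measure_preserving_map (restrict_space M B) (induced_map T B)"
proof -
  let ?N = "restrict_space M B" and ?S = "induced_map T B"
  note S[measurable] = induced_map_measurable_restrict[OF B]
  have fin_eq: "emeasure (distr ?N ?N ?S) E = emeasure ?N E"
    if E: "E \<in> sets M" "E \<subseteq> B" "emeasure M E < \<infinity>" for E
  proof -
    have [measurable]: "E \<in> sets M" "E \<in> sets ?N" using E B by (auto simp: sets_restrict_space_iff)
    have "emeasure (distr ?N ?N ?S) E = (\<integral>\<^sup>+x. indicator E x \<partial>distr ?N ?N ?S)" by simp
    also have "\<dots> = (\<integral>\<^sup>+x. indicator E (?S x) \<partial>?N)" by (subst nn_integral_distr) auto
    also have "\<dots> = (\<integral>\<^sup>+x. indicator E (?S x) * indicator B x \<partial>M)"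
      by (subst nn_integral_restrict_space) auto
    also have "\<dots> = emeasure M E" using E B by (intro nn_integral_indicator_induced_map) auto
    finally show ?thesis using E B by (simp add: emeasure_restrict_space)
  qed
  obtain A :: "nat \<Rightarrow> 'a set" where A: "range A \<subseteq> sets M" "(\<Union>i. A i) = space M"
    "\<And>i. emeasure M (A i) \<noteq> \<infinity>" "incseq A"
    using sigma_finite_incseq by blast
  have A_meas[measurable]: "A i \<in> sets M" for i using A by auto
  have "distr ?N ?N ?S = ?N"
  proof (rule measure_eqI)
    fix E assume "E \<in> sets (distr ?N ?N ?S)"
    then have E: "E \<in> sets M" "E \<subseteq> B" using B by (auto simp: sets_restrict_space_iff)
    have EA: "E \<inter> A i \<in> sets M" "E \<inter> A i \<subseteq> B" "E \<inter> A i \<in> sets ?N" for i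
      using E B by (auto simp: sets_restrict_space_iff)
    have "emeasure M (E \<inter> A i) < \<infinity>" for i
      using emeasure_mono[of "E \<inter> A i" "A i" M] A(3)[of i] by (auto simp: less_top top_unique)
    then have eq: "emeasure (distr ?N ?N ?S) (E \<inter> A i) = emeasure ?N (E \<inter> A i)" for i
      using EA fin_eq by blast
    have inc: "incseq (\<lambda>i. E \<inter> A i)" using A(4) by (auto simp: incseq_def)
    have E_eq: "E = (\<Union>i. E \<inter> A i)" using A(2) sets.sets_into_space[OF E(1)] by blast
    have "emeasure (distr ?N ?N ?S) E = (SUP i. emeasure (distr ?N ?N ?S) (E \<inter> A i))"
      by (subst E_eq, subst SUP_emeasure_incseq) (use EA inc in auto)
    also have "\<dots> = (SUP i. emeasure ?N (E \<inter> A i))" by (simp only: eq)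
    also have "\<dots> = emeasure ?N E"
      by (subst (2) E_eq, subst SUP_emeasure_incseq) (use EA inc in auto)
    finally show "emeasure (distr ?N ?N ?S) E = emeasure ?N E" .
  qed simp
  then show ?thesis using S by (simp add: measure_preserving_map_def)
qed

lemma entrance_integral_tendsto_0:
  assumes B[measurable]: "B \<in> sets M" and H[measurable]: "H \<in> borel_measurable M"
    and fin: "(\<integral>\<^sup>+x. H x \<partial>M) < \<infinity>"
  shows "(\<lambda>n. entrance_integral B H (Suc n)) \<longlonglongrightarrow> 0"
proof (rule entrance_integral_tendsto_0_if_invariant[OF B H])
  have "(\<integral>\<^sup>+x. H x * indicator B x \<partial>M) \<le> (\<integral>\<^sup>+x. H x \<partial>M)"
    by (intro nn_integral_mono) (auto simp: indicator_def)
  then show "(\<integral>\<^sup>+x. H x * indicator B x \<partial>M) < \<infinity>" using fin by (rule le_less_trans)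
  have "(\<integral>\<^sup>+x. H (induced_map T B x) \<partial>restrict_space M B) = (\<integral>\<^sup>+x. H x \<partial>restrict_space M B)"
    by (intro nn_integral_measure_preserving induced_map_preserving measurable_restrict_space1) auto
  then show "(\<integral>\<^sup>+x. H (induced_map T B x) * indicator B x \<partial>M) = (\<integral>\<^sup>+x. H x * indicator B x \<partial>M)"
    by (simp add: nn_integral_restrict_space)
qed

section \<open>Transfer operator of the induced map\<close>

text \<open>
  This is the counterpart of \<open>first_return_decomposition\<close>.  Invariance is replaced by duality, and the
  passage from time \<open>n\<close> to time \<open>n + 1\<close> is possible because \<open>f\<close> and \<open>u\<close> agree off \<open>B\<close>, which is where
  the test function \<open>k\<close> of the induction step lives.
\<close>

lemma first_return_duality:
  fixes f u h :: "'a \<Rightarrow> 'k::{real_normed_field, euclidean_space}"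
  assumes B[measurable]: "B \<in> sets M" and pq: "1 / p + 1 / q = 1"
    and f: "f \<in> Lp M p" and u: "u \<in> Lp M p" and dual: "transfer_dual M T p f u"
    and off: "AE x in M. x \<notin> B \<longrightarrow> f x = u x"
    and h: "h \<in> Lp M q" and h0: "\<And>x. x \<notin> B \<Longrightarrow> h x = 0"
  shows "(\<integral>x. u x * h x \<partial>M) =
     (\<integral>x. (if x \<in> B \<and> hitting_time T B x \<le> enat n then f x * h (induced_map T B x) else 0) \<partial>M) +
     (\<integral>x. (if hitting_time T B x = enat (Suc n) then f x * h ((T ^^ Suc n) x) else 0) \<partial>M)"
proof (induction n)
  case 0
  have "(\<integral>x. u x * h x \<partial>M) = (\<integral>x. f x * h (T x) \<partial>M)"
    using dual pq h by (simp add: transfer_dual_def)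
  also have "\<dots> = (\<integral>x. (if hitting_time T B x = enat (Suc 0) then f x * h ((T ^^ Suc 0) x) else 0) \<partial>M)"
    by (intro Bochner_Integration.integral_cong) (auto simp: hitting_time_eq_one_iff h0)
  finally show ?case by (simp add: hitting_time_not_le_zero)
next
  case (Suc n)
  note [measurable] = Lp_measurable[OF f] Lp_measurable[OF h] Lp_measurable[OF u]
  let ?N = "restrict_space M B" and ?S = "induced_map T B"
  define k where "k x = (if x \<notin> B \<and> hitting_time T B x = enat (Suc n) then h ((T ^^ Suc n) x) else 0)" for x
  have k[measurable]: "k \<in> borel_measurable M" unfolding k_def[abs_def] by measurable
  have k_Lp: "k \<in> Lp M q"
    by (rule Lp_dominated[OF Lp_compose[OF preserving_funpow[of "Suc n"] h] k])
      (auto simp: k_def simp del: funpow.simps)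
  define K where "K x = indicator B x *\<^sub>R h (?S x)" for x
  have K_Lp: "K \<in> Lp M q"
    unfolding K_def[abs_def]
    by (intro Lp_extend_by_zero[OF B] Lp_compose[OF induced_map_preserving[OF B]] Lp_restrict_space[OF B] h)
  have fk_int: "integrable M (\<lambda>x. f x * k x)" and fK_int: "integrable M (\<lambda>x. f x * K x)"
    using Lp_times_integrable[OF f _ pq] k_Lp K_Lp by auto
  have part_int: "integrable M (\<lambda>x. if x \<in> B \<and> P x then f x * h (?S x) else 0)"
    if [measurable]: "Measurable.pred M P" for P
    by (rule Bochner_Integration.integrable_bound[OF fK_int]) (auto simp: K_def)
  let ?C = "\<integral>x. (if x \<in> B \<and> hitting_time T B x = enat (Suc n) then f x * h (?S x) else 0) \<partial>M"
  have "(\<integral>x. (if hitting_time T B x = enat (Suc n) then f x * h ((T ^^ Suc n) x) else 0) \<partial>M)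
      = ?C + (\<integral>x. f x * k x \<partial>M)"
    by (subst Bochner_Integration.integral_add[symmetric, OF part_int fk_int])
      (auto simp: k_def induced_map_eq intro!: Bochner_Integration.integral_cong)
  also have "(\<integral>x. f x * k x \<partial>M) = (\<integral>x. u x * k x \<partial>M)"
    using off by (intro integral_cong_AE) (auto simp: k_def elim!: eventually_mono)
  also have "\<dots> = (\<integral>x. f x * k (T x) \<partial>M)"
    using dual pq k_Lp by (simp add: transfer_dual_def)
  also have "\<dots> = (\<integral>x. (if hitting_time T B x = enat (Suc (Suc n)) then f x * h ((T ^^ Suc (Suc n)) x) else 0) \<partial>M)"
    by (intro Bochner_Integration.integral_cong refl)
      (auto simp: k_def hitting_time_eq_Suc_Suc_iff funpow_swap1)
  moreover have "(\<integral>x. (if x \<in> B \<and> hitting_time T B x \<le> enat (Suc n) then f x * h (?S x) else 0) \<partial>M)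
      = (\<integral>x. (if x \<in> B \<and> hitting_time T B x \<le> enat n then f x * h (?S x) else 0) \<partial>M) + ?C"
    by (subst Bochner_Integration.integral_add[symmetric, OF part_int part_int])
      (auto simp: hitting_time_le_Suc_iff intro!: Bochner_Integration.integral_cong)
  ultimately show ?case using Suc by (simp add: add.assoc)
qed

lemma entrance_remainder_tendsto_0:
  fixes f h :: "'a \<Rightarrow> 'k::{real_normed_field, euclidean_space}"
  assumes B[measurable]: "B \<in> sets M" and pq: "1 / p + 1 / q = 1"
    and f: "f \<in> Lp M p" and h: "h \<in> Lp M q"
  shows "(\<lambda>n. \<integral>x. (if hitting_time T B x = enat (Suc n) then f x * h ((T ^^ Suc n) x) else 0) \<partial>M) \<longlonglongrightarrow> 0"
proof -
  note [measurable] = Lp_measurable[OF f] Lp_measurable[OF h]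
  obtain F H :: "'a \<Rightarrow> ennreal"
    where [measurable]: "F \<in> borel_measurable M" "H \<in> borel_measurable M"
    and fin: "(\<integral>\<^sup>+x. F x \<partial>M) < \<infinity>" "(\<integral>\<^sup>+x. H x \<partial>M) < \<infinity>"
    and le: "\<And>x y. ennreal (norm (f x) * norm (h y)) \<le> F x + H y"
    using Lp_product_separation[OF f h pq] by blast
  let ?G = "\<lambda>n x. if hitting_time T B x = enat (Suc n) then F x else 0"
  let ?g = "\<lambda>n x. if hitting_time T B x = enat (Suc n) then f x * h ((T ^^ Suc n) x) else 0"
  have "(\<lambda>n. \<integral>\<^sup>+x. ?G n x \<partial>M) \<longlonglongrightarrow> (\<integral>\<^sup>+x. 0 \<partial>M)"
  proof (rule nn_integral_dominated_convergence[where w = F])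
    \<comment> \<open>Each point enters \<open>B\<close> for the first time at most once.\<close>
    have "\<forall>\<^sub>F n in sequentially. ?G n x = 0" for x
    proof (cases "hitting_time T B x")
      case (enat m)
      then show ?thesis by (auto simp: eventually_sequentially intro!: exI[of _ m])
    qed simp
    then show "AE x in M. (\<lambda>n. ?G n x) \<longlonglongrightarrow> 0" by (intro AE_I2 tendsto_eventually)
  qed (use fin in auto)
  moreover have "(\<lambda>n. entrance_integral B H (Suc n)) \<longlonglongrightarrow> 0"
    using fin by (intro entrance_integral_tendsto_0) auto
  ultimately have lim: "(\<lambda>n. (\<integral>\<^sup>+x. ?G n x \<partial>M) + entrance_integral B H (Suc n)) \<longlonglongrightarrow> 0"
    using tendsto_add by fastforce
  have bound: "ennreal (norm (\<integral>x. ?g n x \<partial>M)) \<le> (\<integral>\<^sup>+x. ?G n x \<partial>M) + entrance_integral B H (Suc n)" for n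
  proof -
    have "integrable M (\<lambda>x. f x * h ((T ^^ Suc n) x))"
      using Lp_times_integrable[OF f Lp_compose[OF preserving_funpow h] pq] .
    then have "integrable M (?g n)"
      by (rule Bochner_Integration.integrable_bound) (auto simp del: funpow.simps)
    then have "ennreal (norm (\<integral>x. ?g n x \<partial>M)) \<le> (\<integral>\<^sup>+x. norm (?g n x) \<partial>M)"
      by (rule integral_norm_bound_ennreal)
    also have "\<dots> \<le> (\<integral>\<^sup>+x. ?G n x + (if hitting_time T B x = enat (Suc n) then H ((T ^^ Suc n) x) else 0) \<partial>M)"
      using le by (intro nn_integral_mono) (auto simp: norm_mult simp del: funpow.simps)
    also have "\<dots> = (\<integral>\<^sup>+x. ?G n x \<partial>M) + entrance_integral B H (Suc n)"
      unfolding entrance_integral_def by (rule nn_integral_add) measurable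
    finally show ?thesis .
  qed
  have "(\<lambda>n. ennreal (norm (\<integral>x. ?g n x \<partial>M))) \<longlonglongrightarrow> 0"
    by (rule tendsto_sandwich[OF _ _ tendsto_const lim]) (use bound in auto)
  then have "(\<lambda>n. norm (\<integral>x. ?g n x \<partial>M)) \<longlonglongrightarrow> 0" by (simp add: ennreal_tendsto_0_iff)
  then show ?thesis by (rule tendsto_norm_zero_cancel)
qed

text \<open>
  Letting \<open>n\<close> tend to infinity in \<open>first_return_duality\<close>, for test functions on \<open>B\<close> extended by zero.
  The product \<open>f (h \<circ> S)\<close>, with \<open>S\<close> the induced map, is integrable on \<open>B\<close> because \<open>S\<close> preserves the
  measure there; it dominates the integrals over the points that have returned by time \<open>n\<close>.
\<close>

lemma transfer_dual_induced_map:
  fixes f u :: "'a \<Rightarrow> 'k::{real_normed_field, euclidean_space}"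
  assumes B[measurable]: "B \<in> sets M"
    and f: "f \<in> Lp M p" and u: "u \<in> Lp M p" and dual: "transfer_dual M T p f u"
    and off: "AE x in M. x \<notin> B \<longrightarrow> f x = u x"
  shows "transfer_dual (restrict_space M B) (induced_map T B) p f u"
  unfolding transfer_dual_def
proof (intro allI impI ballI)
  let ?N = "restrict_space M B" and ?S = "induced_map T B"
  fix q h0 assume pq: "1 / p + 1 / q = 1" and h0: "(h0 :: 'a \<Rightarrow> 'k) \<in> Lp ?N q"
  define h where "h x = indicator B x *\<^sub>R h0 x" for x
  have h: "h \<in> Lp M q" unfolding h_def[abs_def] by (rule Lp_extend_by_zero[OF B h0])
  note [measurable] = Lp_measurable[OF f] Lp_measurable[OF h]
  let ?r = "\<lambda>n x. if x \<in> B \<and> hitting_time T B x \<le> enat n then f x * h (?S x) else 0"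
  define K where "K x = indicator B x *\<^sub>R h (?S x)" for x
  have "K \<in> Lp M q"
    unfolding K_def[abs_def]
    by (intro Lp_extend_by_zero[OF B] Lp_compose[OF induced_map_preserving[OF B]] Lp_restrict_space[OF B] h)
  then have fK_int: "integrable M (\<lambda>x. f x * K x)" using Lp_times_integrable[OF f _ pq] by blast
  have "(\<lambda>n. \<integral>x. ?r n x \<partial>M) \<longlonglongrightarrow> (\<integral>x. f x * K x \<partial>M)"
  proof (rule integral_dominated_convergence[where w = "\<lambda>x. norm (f x * K x)"])
    show "AE x in M. (\<lambda>n. ?r n x) \<longlonglongrightarrow> f x * K x"
    proof (rule AE_mp[OF AE_hitting_time_finite[OF B]], intro AE_I2 impI)
      fix x assume fin: "x \<in> B \<longrightarrow> hitting_time T B x \<noteq> \<infinity>"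
      have "\<forall>\<^sub>F n in sequentially. ?r n x = f x * K x"
      proof (cases "x \<in> B")
        case True
        then obtain m where "hitting_time T B x = enat m" using fin by auto
        then show ?thesis using True
          by (auto simp: eventually_sequentially K_def intro!: exI[of _ m])
      qed (simp add: K_def)
      then show "(\<lambda>n. ?r n x) \<longlonglongrightarrow> f x * K x" by (rule tendsto_eventually)
    qed
  next
    show "AE x in M. norm (?r n x) \<le> norm (f x * K x)" for n by (auto simp: K_def)
  qed (use fK_int in auto)
  moreover note entrance_remainder_tendsto_0[OF B pq f h]
  ultimately have "(\<lambda>n. (\<integral>x. ?r n x \<partial>M) +
      (\<integral>x. (if hitting_time T B x = enat (Suc n) then f x * h ((T ^^ Suc n) x) else 0) \<partial>M))
      \<longlonglongrightarrow> (\<integral>x. f x * K x \<partial>M) + 0"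
    by (rule tendsto_add)
  moreover have "(\<integral>x. ?r n x \<partial>M) +
      (\<integral>x. (if hitting_time T B x = enat (Suc n) then f x * h ((T ^^ Suc n) x) else 0) \<partial>M)
      = (\<integral>x. u x * h x \<partial>M)" for n
    by (rule first_return_duality[OF B pq f u dual off h, symmetric]) (simp add: h_def)
  ultimately have eq: "(\<integral>x. u x * h x \<partial>M) = (\<integral>x. f x * K x \<partial>M)" by (simp only: LIMSEQ_const_iff add_0_right)
  have "(\<integral>x. u x * h0 x \<partial>?N) = (\<integral>x. u x * h x \<partial>M)"
    by (subst integral_restrict_space) (auto simp: h_def)
  also note eq
  also have "(\<integral>x. f x * K x \<partial>M) = (\<integral>x. f x * h0 (?S x) \<partial>?N)"
    by (subst integral_restrict_space)
      (auto simp: h_def K_def indicator_def induced_map_in intro!: Bochner_Integration.integral_cong)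
  finally show "(\<integral>x. u x * h0 x \<partial>?N) = (\<integral>x. f x * h0 (?S x) \<partial>?N)" .
qed

end

theorem proposition0p1:
  fixes m :: "'a::polish_space measure"
    and T :: "'a \<Rightarrow> 'a"
    and B :: "'a set"
    and p :: ennreal
    and f g :: "'a \<Rightarrow> 'k::{real_normed_field, euclidean_space}"
  assumes "sets m = sets borel"
    and "sigma_finite_measure m"
    and "measure_preserving_map m T"
    and "recurrent m T"
    and "B \<in> sets m" and "emeasure m B > 0"
    and "1 \<le> p"
    and "f \<in> Lp m p" and "g \<in> Lp m p"
    and "AE x in m. x \<notin> B \<longrightarrow> g x = 0"
    and "AE x in m. f x - transfer_operator m T p f x = g x"
  shows "AE x in restrict_space m B.
           f x - transfer_operator (restrict_space m B) (induced_map T B) p f x = g x"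
proof -
  interpret recurrent_system m T
    using assms by (auto simp: recurrent_system_def recurrent_system_axioms_def)
  let ?N = "restrict_space m B"
  interpret N: sigma_finite_measure ?N
    using assms by (intro sigma_finite_measure_restrict_space)
  obtain u where u: "u \<in> Lp m p" and dual: "transfer_dual m T p f u"
    using transfer_dual_exists[OF assms(3,7,8)] .
  have "AE x in m. transfer_operator m T p f x = u x"
    using transfer_operator_eqI[OF assms(7) u dual] .
  with assms(11) have fug: "AE x in m. f x - u x = g x" by eventually_elim simp
  with assms(10) have off: "AE x in m. x \<notin> B \<longrightarrow> f x = u x" by eventually_elim auto
  have "transfer_dual ?N (induced_map T B) p f u"
    by (rule transfer_dual_induced_map[OF assms(5,8) u dual off])
  then have "AE x in ?N. transfer_operator ?N (induced_map T B) p f x = u x"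
    using Lp_restrict_space[OF assms(5) u] by (intro N.transfer_operator_eqI[OF assms(7)])
  moreover have "AE x in ?N. f x - u x = g x"
    using fug assms(5) by (subst AE_restrict_space_iff) (auto elim: eventually_mono)
  ultimately show ?thesis by eventually_elim simp
qed

end
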